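(* Let $(M,\omega)$ be a symplectic manifold and let $f:M\to M$ be a diffeomorphism such that $f^*\omega=a\,\omega$ with $a\in(0,1)$ a constant. Let $S\subset M$ be a closed $f$-invariant surface. Then $S$ is isotropic.
   Context: A closed surface is a compact 2-dimensional submanifold without boundary; $f$-invariant means $f(S)=S$. A submanifold $L$ of $M$ is isotropic if $\omega(u,v)=0$ for all $x\in L$ and all $u,v\in T_xL$. *)

theory Defs
  imports "HOL-Analysis.Analysis"
begin

section \<open>Smooth functions on open sets\<close>

text \<open>Only meant for open \<open>S\<close>: differentiability is \<open>at x\<close>, not within \<open>S\<close>. On an open subset of a
  Euclidean space, \<open>C_diff k S f\<close> says that \<open>f\<close> is \<open>k\<close> times continuously differentiable.\<close>

primrec C_diff :: "nat \<Rightarrow> 'e::real_normed_vector set \<Rightarrow> ('e \<Rightarrow> 'f::real_normed_vector) \<Rightarrow> bool" where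
  "C_diff 0 S f \<longleftrightarrow> continuous_on S f"
| "C_diff (Suc k) S f \<longleftrightarrow>
     (\<forall>x\<in>S. f differentiable (at x)) \<and>
     (\<forall>v. C_diff k S (\<lambda>x. frechet_derivative f (at x) v))"

definition smooth_on :: "'e::real_normed_vector set \<Rightarrow> ('e \<Rightarrow> 'f::real_normed_vector) \<Rightarrow> bool" where
  "smooth_on S f \<longleftrightarrow> (\<forall>k. C_diff k S f)"

section \<open>Smooth manifolds\<close>

text \<open>A chart is a pair of a domain and a coordinate map; the values of the coordinate map outside
  the domain are irrelevant. The type \<open>'e\<close> is the model space, so the dimension is \<open>DIM('e)\<close>.\<close>

type_synonym ('a, 'e) chart = "'a set \<times> ('a \<Rightarrow> 'e)"

abbreviation cdom :: "('a, 'e) chart \<Rightarrow> 'a set" where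
  "cdom c \<equiv> fst c"

abbreviation cmap :: "('a, 'e) chart \<Rightarrow> 'a \<Rightarrow> 'e" where
  "cmap c \<equiv> snd c"

definition cinv :: "('a, 'e) chart \<Rightarrow> 'e \<Rightarrow> 'a" where
  "cinv c = inv_into (cdom c) (cmap c)"

definition is_chart :: "'a topology \<Rightarrow> ('a, 'e::euclidean_space) chart \<Rightarrow> bool" where
  "is_chart X c \<longleftrightarrow>
     openin X (cdom c) \<and> open (cmap c ` cdom c) \<and>
     homeomorphic_map (subtopology X (cdom c)) (top_of_set (cmap c ` cdom c)) (cmap c)"

definition compatible :: "('a, 'e::euclidean_space) chart \<Rightarrow> ('a, 'e) chart \<Rightarrow> bool" where
  "compatible c d \<longleftrightarrow>
     smooth_on (cmap c ` (cdom c \<inter> cdom d)) (cmap d \<circ> cinv c) \<and>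
     smooth_on (cmap d ` (cdom c \<inter> cdom d)) (cmap c \<circ> cinv d)"

definition second_countable_space :: "'a topology \<Rightarrow> bool" where
  "second_countable_space X \<longleftrightarrow>
     (\<exists>\<B>. countable \<B> \<and> (\<forall>B\<in>\<B>. openin X B) \<and>
       (\<forall>U x. openin X U \<and> x \<in> U \<longrightarrow> (\<exists>B\<in>\<B>. x \<in> B \<and> B \<subseteq> U)))"

text \<open>The smooth structure is given by its maximal atlas \<open>A\<close>.\<close>

definition smooth_manifold :: "'a topology \<Rightarrow> ('a, 'e::euclidean_space) chart set \<Rightarrow> bool" where
  "smooth_manifold X A \<longleftrightarrow>
     Hausdorff_space X \<and> second_countable_space X \<and>
     (\<forall>c\<in>A. is_chart X c) \<and> \<Union> (cdom ` A) = topspace X \<and>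
     (\<forall>c\<in>A. \<forall>d\<in>A. compatible c d) \<and>
     (\<forall>c. is_chart X c \<and> (\<forall>d\<in>A. compatible c d) \<longrightarrow> c \<in> A)"

definition smooth_map ::
    "'a topology \<Rightarrow> ('a, 'e::euclidean_space) chart set \<Rightarrow>
     'b topology \<Rightarrow> ('b, 'f::euclidean_space) chart set \<Rightarrow> ('a \<Rightarrow> 'b) \<Rightarrow> bool" where
  "smooth_map X A Y B f \<longleftrightarrow>
     continuous_map X Y f \<and>
     (\<forall>c\<in>A. \<forall>d\<in>B. smooth_on (cmap c ` (cdom c \<inter> f -` cdom d)) (cmap d \<circ> f \<circ> cinv c))"

definition diffeomorphism ::
    "'a topology \<Rightarrow> ('a, 'e::euclidean_space) chart set \<Rightarrow>
     'b topology \<Rightarrow> ('b, 'f::euclidean_space) chart set \<Rightarrow> ('a \<Rightarrow> 'b) \<Rightarrow> bool" where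
  "diffeomorphism X A Y B f \<longleftrightarrow>
     smooth_map X A Y B f \<and>
     (\<exists>g. smooth_map Y B X A g \<and>
       (\<forall>x\<in>topspace X. g (f x) = x) \<and> (\<forall>y\<in>topspace Y. f (g y) = y))"

section \<open>Tangent vectors\<close>

definition charts_at :: "('a, 'e) chart set \<Rightarrow> 'a \<Rightarrow> ('a, 'e) chart set" where
  "charts_at A x = {c \<in> A. x \<in> cdom c}"

text \<open>A tangent vector at \<open>x\<close> is the family of its coordinate expressions in all charts around \<open>x\<close>,
  related by the derivatives of the transition maps (and \<open>0\<close> at all other arguments, so that
  equality of tangent vectors is equality of functions). The vector space operations are pointwise.\<close>

type_synonym ('a, 'e) tvec = "('a, 'e) chart \<Rightarrow> 'e"

definition tangent_space ::
    "('a, 'e::euclidean_space) chart set \<Rightarrow> 'a \<Rightarrow> ('a, 'e) tvec set" where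
  "tangent_space A x =
     {v. (\<forall>c. c \<notin> charts_at A x \<longrightarrow> v c = 0) \<and>
         (\<forall>c\<in>charts_at A x. \<forall>d\<in>charts_at A x.
            v d = frechet_derivative (cmap d \<circ> cinv c) (at (cmap c x)) (v c))}"

text \<open>The tangent vector at \<open>x\<close> whose coordinate expression in the chart \<open>c\<close> around \<open>x\<close> is \<open>w\<close>.\<close>

definition tvec_of_coord ::
    "('a, 'e::euclidean_space) chart set \<Rightarrow> ('a, 'e) chart \<Rightarrow> 'a \<Rightarrow> 'e \<Rightarrow> ('a, 'e) tvec" where
  "tvec_of_coord A c x w =
     (\<lambda>d. if d \<in> charts_at A x
          then frechet_derivative (cmap d \<circ> cinv c) (at (cmap c x)) w else 0)"

text \<open>The differential at \<open>x\<close>. By the chain rule, the result does not depend on the choice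
  of the chart around \<open>x\<close>.\<close>

definition differential ::
    "('a, 'e::euclidean_space) chart set \<Rightarrow> ('b, 'f::euclidean_space) chart set \<Rightarrow>
     ('a \<Rightarrow> 'b) \<Rightarrow> 'a \<Rightarrow> ('a, 'e) tvec \<Rightarrow> ('b, 'f) tvec" where
  "differential A B f x v =
     (\<lambda>d. if d \<in> charts_at B (f x)
          then (let c = (SOME c. c \<in> charts_at A x)
                in frechet_derivative (cmap d \<circ> f \<circ> cinv c) (at (cmap c x)) (v c))
          else 0)"

section \<open>Symplectic forms\<close>

text \<open>Values of a form outside of \<open>tangent_space A x\<close> are irrelevant.\<close>

type_synonym ('a, 'e) form2 = "'a \<Rightarrow> ('a, 'e) tvec \<Rightarrow> ('a, 'e) tvec \<Rightarrow> real"

definition form_coord ::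
    "('a, 'e::euclidean_space) chart set \<Rightarrow> ('a, 'e) form2 \<Rightarrow> ('a, 'e) chart \<Rightarrow>
     'e \<Rightarrow> 'e \<Rightarrow> 'e \<Rightarrow> real" where
  "form_coord A \<omega> c p u w =
     \<omega> (cinv c p) (tvec_of_coord A c (cinv c p) u) (tvec_of_coord A c (cinv c p) w)"

definition smooth_2form ::
    "'a topology \<Rightarrow> ('a, 'e::euclidean_space) chart set \<Rightarrow> ('a, 'e) form2 \<Rightarrow> bool" where
  "smooth_2form X A \<omega> \<longleftrightarrow>
     (\<forall>x\<in>topspace X.
        (\<forall>u\<in>tangent_space A x. \<forall>v\<in>tangent_space A x. \<forall>w\<in>tangent_space A x. \<forall>r s.
           \<omega> x (\<lambda>c. r *\<^sub>R u c + s *\<^sub>R v c) w = r * \<omega> x u w + s * \<omega> x v w) \<and>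
        (\<forall>u\<in>tangent_space A x. \<forall>v\<in>tangent_space A x. \<omega> x u v = - \<omega> x v u)) \<and>
     (\<forall>c\<in>A. \<forall>u w. smooth_on (cmap c ` cdom c) (\<lambda>p. form_coord A \<omega> c p u w))"

text \<open>The cyclic sum is the value of the exterior derivative on the constant coordinate vector
  fields \<open>u\<close>, \<open>v\<close>, \<open>w\<close>, whose brackets vanish.\<close>

definition closed_2form ::
    "('a, 'e::euclidean_space) chart set \<Rightarrow> ('a, 'e) form2 \<Rightarrow> bool" where
  "closed_2form A \<omega> \<longleftrightarrow>
     (\<forall>c\<in>A. \<forall>p\<in>cmap c ` cdom c. \<forall>u v w.
        frechet_derivative (\<lambda>q. form_coord A \<omega> c q v w) (at p) u +
        frechet_derivative (\<lambda>q. form_coord A \<omega> c q w u) (at p) v +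
        frechet_derivative (\<lambda>q. form_coord A \<omega> c q u v) (at p) w = 0)"

definition nondegenerate_2form ::
    "'a topology \<Rightarrow> ('a, 'e::euclidean_space) chart set \<Rightarrow> ('a, 'e) form2 \<Rightarrow> bool" where
  "nondegenerate_2form X A \<omega> \<longleftrightarrow>
     (\<forall>x\<in>topspace X. \<forall>u\<in>tangent_space A x.
        (\<forall>v\<in>tangent_space A x. \<omega> x u v = 0) \<longrightarrow> u = (\<lambda>_. 0))"

definition symplectic_manifold ::
    "'a topology \<Rightarrow> ('a, 'e::euclidean_space) chart set \<Rightarrow> ('a, 'e) form2 \<Rightarrow> bool" where
  "symplectic_manifold X A \<omega> \<longleftrightarrow>
     smooth_manifold X A \<and> smooth_2form X A \<omega> \<and> closed_2form A \<omega> \<and> nondegenerate_2form X A \<omega>"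

definition pullback_form ::
    "('a, 'e::euclidean_space) chart set \<Rightarrow> ('b, 'f::euclidean_space) chart set \<Rightarrow>
     ('a \<Rightarrow> 'b) \<Rightarrow> ('b, 'f) form2 \<Rightarrow> ('a, 'e) form2" where
  "pullback_form A B f \<omega> x u v = \<omega> (f x) (differential A B f x u) (differential A B f x v)"

section \<open>Submanifolds\<close>

text \<open>\<open>c\<close> is a slice chart flattening \<open>S\<close> to the linear subspace \<open>V\<close>.\<close>

definition slice_chart ::
    "('a, 'e::euclidean_space) chart set \<Rightarrow> 'a set \<Rightarrow> ('a, 'e) chart \<Rightarrow> 'e set \<Rightarrow> bool" where
  "slice_chart A S c V \<longleftrightarrow>
     c \<in> A \<and> subspace V \<and> cmap c ` (cdom c \<inter> S) = cmap c ` cdom c \<inter> V"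

text \<open>Embedded submanifolds without boundary.\<close>

definition submanifold ::
    "'a topology \<Rightarrow> ('a, 'e::euclidean_space) chart set \<Rightarrow> nat \<Rightarrow> 'a set \<Rightarrow> bool" where
  "submanifold X A k S \<longleftrightarrow>
     S \<subseteq> topspace X \<and>
     (\<forall>x\<in>S. \<exists>c V. slice_chart A S c V \<and> x \<in> cdom c \<and> dim V = k)"

definition closed_surface ::
    "'a topology \<Rightarrow> ('a, 'e::euclidean_space) chart set \<Rightarrow> 'a set \<Rightarrow> bool" where
  "closed_surface X A S \<longleftrightarrow> submanifold X A 2 S \<and> compactin X S"

text \<open>The tangent space of a submanifold, as a subspace of the tangent space of the ambient
  manifold. It can be computed in any slice chart.\<close>

definition sub_tangent_space ::
    "('a, 'e::euclidean_space) chart set \<Rightarrow> 'a set \<Rightarrow> 'a \<Rightarrow> ('a, 'e) tvec set" where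
  "sub_tangent_space A S x =
     {v \<in> tangent_space A x. \<exists>c V. slice_chart A S c V \<and> x \<in> cdom c \<and> v c \<in> V}"

definition isotropic ::
    "('a, 'e::euclidean_space) chart set \<Rightarrow> ('a, 'e) form2 \<Rightarrow> 'a set \<Rightarrow> bool" where
  "isotropic A \<omega> L \<longleftrightarrow>
     (\<forall>x\<in>L. \<forall>u\<in>sub_tangent_space A L x. \<forall>v\<in>sub_tangent_space A L x. \<omega> x u v = 0)"

end

theory Submission
  imports Defs
begin

text \<open>
  The reason is that \<open>f\<close> would have to shrink the finite area of \<open>S\<close> while mapping \<open>S\<close> onto itself.
  The restriction of \<open>\<omega>\<close> to \<open>S\<close> is a 2-form on a surface, so in coordinates it is a single function,
  and its absolute value is an area density. Let \<open>M\<close> be the total area of \<open>S\<close> for this density.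
  It is finite because \<open>S\<close> is compact, and the absolute value makes it independent of orientations. As \<open>f\<close> maps \<open>S\<close> bijectively onto itself and scales the density by \<open>a\<close>, the change of
  variables formula gives \<open>M = a * M\<close>, so \<open>M = 0\<close>. A continuous nonnegative density with vanishing
  integral is zero, and an alternating form on a plane that vanishes on a basis is zero.

  The area is not constructed as a measure on \<open>S\<close>. Instead, \<open>S\<close> is cut into finitely many disjoint
  measurable pieces, each inside one slice chart, and \<open>M\<close> is the sum of the integrals over
  their coordinate images in \<open>real^2\<close>. The identity \<open>M = a * M\<close> is \<open>contracted_area_vanishes\<close>; its
  Jacobian hypothesis is supplied by \<open>area_density_transforms\<close>, which rests on the fact that the
  differential of \<open>f\<close> preserves tangency to \<open>S\<close> (\<open>Dcoord_slice\<close>). The partition may be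
  chosen such that it begins with a full neighbourhood of any given point of \<open>S\<close>
  (\<open>area_density_vanishes\<close>), so the vanishing of \<open>M\<close> gives the vanishing of the density at that point.
\<close>

section \<open>Areas in the plane\<close>

text \<open>The real-valued case of the change of variables theorem, obtained by regarding real numbers as
  vectors in \<open>real^1\<close>.\<close>

lemma change_of_variables_plane:
  fixes g :: "real^2 \<Rightarrow> real^2" and h :: "real^2 \<Rightarrow> real"
  assumes "Q \<in> sets lebesgue"
    and "\<And>p. p \<in> Q \<Longrightarrow> (g has_derivative g' p) (at p within Q)"
    and "inj_on g Q"
    and "(\<lambda>p. \<bar>det (matrix (g' p))\<bar> * h (g p)) absolutely_integrable_on Q"
  shows "(h has_integral integral Q (\<lambda>p. \<bar>det (matrix (g' p))\<bar> * h (g p))) (g ` Q)"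
proof -
  have "(\<lambda>p. vec (h p) :: real^1) absolutely_integrable_on (g ` Q) \<and>
      integral (g ` Q) (\<lambda>p. vec (h p) :: real^1)
        = vec (integral Q (\<lambda>p. \<bar>det (matrix (g' p))\<bar> * h (g p)))"
    using has_absolute_integral_change_of_variables
        [OF assms(1-3), of "\<lambda>p. vec (h p) :: real^1"
          "vec (integral Q (\<lambda>p. \<bar>det (matrix (g' p))\<bar> * h (g p)))"] assms(4)
    by (simp add: absolutely_integrable_on_1_iff integral_on_1_eq)
  then show ?thesis
    by (simp add: absolutely_integrable_on_1_iff integral_on_1_eq absolutely_integrable_on_def
        has_integral_iff)
qed

text \<open>The measure-theoretic core. Think of \<open>\<psi> k\<close> as parametrising a piece of \<open>S\<close> by \<open>P k\<close>, of \<open>h k\<close>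
  as an area density there, and of \<open>G k l\<close> as the coordinate expression of \<open>f\<close> on the part \<open>Q k l\<close>
  of the \<open>k\<close>-th piece that \<open>f\<close> sends into the \<open>l\<close>-th one. The sets \<open>Q k l\<close> with \<open>k\<close> fixed partition
  \<open>P k\<close>, because \<open>f\<close> maps \<open>S\<close> into itself; their images under \<open>G k l\<close> with \<open>l\<close> fixed partition \<open>P l\<close>,
  because \<open>f\<close> maps \<open>S\<close> bijectively onto itself. Summing the change of variables formula over all
  pairs gives \<open>M = a * M\<close> for the total area \<open>M\<close>. As the pieces are disjoint, no transition maps
  between different parametrisations enter.\<close>

lemma contracted_area_vanishes:
  fixes f :: "'b \<Rightarrow> 'b" and P :: "'i \<Rightarrow> (real^2) set" and \<psi> :: "'i \<Rightarrow> real^2 \<Rightarrow> 'b"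
    and h :: "'i \<Rightarrow> real^2 \<Rightarrow> real" and G :: "'i \<Rightarrow> 'i \<Rightarrow> real^2 \<Rightarrow> real^2"
  assumes Q: "\<And>k l. Q k l = {p \<in> P k. f (\<psi> k p) \<in> \<psi> l ` P l}"
    and "finite I"
    and int: "\<And>k. k \<in> I \<Longrightarrow> h k absolutely_integrable_on P k"
    and inj: "\<And>k. k \<in> I \<Longrightarrow> inj_on (\<psi> k) (P k)"
    and disj: "\<And>k l. k \<in> I \<Longrightarrow> l \<in> I \<Longrightarrow> k \<noteq> l \<Longrightarrow> \<psi> k ` P k \<inter> \<psi> l ` P l = {}"
    and cover: "(\<Union>k\<in>I. \<psi> k ` P k) = S"
    and f: "f ` S = S" "inj_on f S"
    and meas: "\<And>k l. k \<in> I \<Longrightarrow> l \<in> I \<Longrightarrow> Q k l \<in> sets lebesgue"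
    and G: "\<And>k l p. k \<in> I \<Longrightarrow> l \<in> I \<Longrightarrow> p \<in> Q k l \<Longrightarrow> G k l p \<in> P l \<and> \<psi> l (G k l p) = f (\<psi> k p)"
    and der: "\<And>k l p. k \<in> I \<Longrightarrow> l \<in> I \<Longrightarrow> p \<in> Q k l \<Longrightarrow> (G k l has_derivative G' k l p) (at p)"
    and jac: "\<And>k l p. k \<in> I \<Longrightarrow> l \<in> I \<Longrightarrow> p \<in> Q k l \<Longrightarrow>
                \<bar>det (matrix (G' k l p))\<bar> * h l (G k l p) = a * h k p"
    and "a \<noteq> 1"
  shows "(\<Sum>k\<in>I. integral (P k) (h k)) = 0"
proof -
  let ?M = "\<Sum>k\<in>I. integral (P k) (h k)"
  have intQ: "h k absolutely_integrable_on Q k l" if "k \<in> I" "l \<in> I" for k l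
    by (rule set_integrable_subset[OF int[OF that(1)] meas[OF that]]) (auto simp: Q)
  have source: "(h k has_integral (\<Sum>l\<in>I. integral (Q k l) (h k))) (P k)" if k: "k \<in> I" for k
  proof -
    have PQ: "P k = (\<Union>l\<in>I. Q k l)"
      using cover f k unfolding Q by blast
    have "negligible (Q k l \<inter> Q k m)" if "l \<in> I" "m \<in> I" "l \<noteq> m" for l m
    proof -
      have "Q k l \<inter> Q k m = {}"
        using disj[OF that] unfolding Q by blast
      then show ?thesis by simp
    qed
    then show ?thesis
      unfolding PQ using \<open>finite I\<close> intQ[OF k]
      by (intro has_integral_UN) (auto simp: pairwise_def absolutely_integrable_on_def)
  qed
  have target: "(h l has_integral (\<Sum>k\<in>I. a * integral (Q k l) (h k))) (P l)" if l: "l \<in> I" for l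
  proof -
    have GP: "(\<Union>k\<in>I. G k l ` Q k l) = P l"
    proof
      show "(\<Union>k\<in>I. G k l ` Q k l) \<subseteq> P l"
        using G l by blast
      show "P l \<subseteq> (\<Union>k\<in>I. G k l ` Q k l)"
      proof
        fix q assume q: "q \<in> P l"
        then have "\<psi> l q \<in> f ` S"
          using cover f(1) l by auto
        then obtain k p where k: "k \<in> I" and p: "p \<in> P k" and eq: "\<psi> l q = f (\<psi> k p)"
          unfolding cover[symmetric] by blast
        have pQ: "p \<in> Q k l"
          using p q by (auto simp: Q eq[symmetric])
        have "G k l p = q"
          using G[OF k l pQ] inj[OF l] q eq by (simp add: inj_on_def)
        then show "q \<in> (\<Union>k\<in>I. G k l ` Q k l)"
          using k pQ by blast
      qed
    qed
    have G_eqD: "k = m \<and> p = q"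
      if "k \<in> I" "m \<in> I" "p \<in> Q k l" "q \<in> Q m l" "G k l p = G m l q" for k m p q
    proof -
      have P: "p \<in> P k" "q \<in> P m" using that by (auto simp: Q)
      have "f (\<psi> k p) = f (\<psi> m q)"
        using G[OF that(1) l that(3)] G[OF that(2) l that(4)] that(5) by simp
      moreover have "\<psi> k p \<in> S" "\<psi> m q \<in> S"
        using P that cover by auto
      ultimately have eq: "\<psi> k p = \<psi> m q" using f(2) by (simp add: inj_on_def)
      then have "k = m" using disj[OF that(1,2)] P by blast
      then show ?thesis using inj[OF that(1)] eq P by (simp add: inj_on_def)
    qed
    have "(h l has_integral (a * integral (Q k l) (h k))) (G k l ` Q k l)" if k: "k \<in> I" for k
    proof -
      let ?J = "\<lambda>p. \<bar>det (matrix (G' k l p))\<bar> * h l (G k l p)"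
      have "(\<lambda>p. a * h k p) absolutely_integrable_on Q k l"
        using intQ[OF k l] by (rule set_integrable_mult_right)
      then have J: "?J absolutely_integrable_on Q k l"
        by (rule iffD1[OF set_integrable_cong[OF refl refl], rotated]) (simp add: jac[OF k l])
      have inj: "inj_on (G k l) (Q k l)"
        using G_eqD[OF k k] by (auto intro: inj_onI)
      have "integral (Q k l) ?J = a * integral (Q k l) (h k)"
        by (subst integral_cong[where g="\<lambda>p. a * h k p"]) (simp_all add: jac[OF k l])
      with change_of_variables_plane[OF meas[OF k l] has_derivative_at_withinI[OF der[OF k l]] inj J]
      show ?thesis by simp
    qed
    then show ?thesis
      unfolding GP[symmetric] using \<open>finite I\<close> G_eqD
      by (intro has_integral_UN) (auto simp: pairwise_def intro!: empty_imp_negligible)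
  qed
  have "?M = (\<Sum>l\<in>I. \<Sum>k\<in>I. a * integral (Q k l) (h k))"
    by (intro sum.cong refl integral_unique[OF target])
  also have "\<dots> = a * (\<Sum>k\<in>I. \<Sum>l\<in>I. integral (Q k l) (h k))"
    by (subst sum.swap) (simp add: sum_distrib_left)
  also have "(\<Sum>k\<in>I. \<Sum>l\<in>I. integral (Q k l) (h k)) = ?M"
    by (intro sum.cong refl integral_unique[OF source, symmetric])
  finally show ?thesis
    using \<open>a \<noteq> 1\<close> by simp
qed

lemma alternating_plane_det:
  fixes \<beta> :: "real^2 \<Rightarrow> real^2 \<Rightarrow> real"
  assumes lin: "\<And>t. linear (\<lambda>s. \<beta> s t)" and alt: "\<And>s t. \<beta> s t = - \<beta> t s"
  shows "\<beta> s t = (s$1 * t$2 - s$2 * t$1) * \<beta> (axis 1 1) (axis 2 1)"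
proof -
  let ?e = "axis 1 1 :: real^2" and ?f = "axis 2 1 :: real^2"
  have exp: "v = v$1 *\<^sub>R ?e + v$2 *\<^sub>R ?f" for v :: "real^2"
    by (simp add: vec_eq_iff forall_2 axis_def)
  have left: "\<beta> v t = v$1 * \<beta> ?e t + v$2 * \<beta> ?f t" for v t
    using arg_cong[OF exp[of v], of "\<lambda>v. \<beta> v t"]
    by (simp add: linear_add[OF lin] linear_cmul[OF lin])
  have zero: "\<beta> v v = 0" for v using alt[of v v] by simp
  show ?thesis
    using left[of s t] left[of t ?e] left[of t ?f] alt[of ?e t] alt[of ?f t] alt[of ?f ?e]
      zero[of ?e] zero[of ?f]
    by (simp add: algebra_simps)
qed

text \<open>This is why the density of a 2-form on a surface changes by the Jacobian determinant, which is
  what the change of variables formula for areas needs.\<close>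

lemma alternating_linear_image:
  fixes \<beta> :: "real^2 \<Rightarrow> real^2 \<Rightarrow> real"
  assumes "\<And>t. linear (\<lambda>s. \<beta> s t)" "\<And>s t. \<beta> s t = - \<beta> t s" 
  shows "\<beta> (T (axis 1 1)) (T (axis 2 1)) = det (matrix T) * \<beta> (axis 1 1) (axis 2 1)"
  unfolding alternating_plane_det[OF assms, of "T (axis 1 1)" "T (axis 2 1)"]
  by (simp add: det_2 matrix_def)

lemma absolutely_integrable_compact_subset:
  fixes h :: "'n::euclidean_space \<Rightarrow> real"
  assumes "compact K" "continuous_on K h" "P \<in> sets lebesgue" "P \<subseteq> K"
  shows "h absolutely_integrable_on P"
proof -
  have "integrable lborel (\<lambda>x. indicator K x *\<^sub>R h x)"
    using assms by (intro borel_integrable_compact)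
  then have "h absolutely_integrable_on K"
    unfolding set_integrable_def by (simp add: integrable_completion)
  then show ?thesis using assms(3,4) by (rule set_integrable_subset)
qed

lemma zero_integral_on_open:
  fixes h :: "'n::euclidean_space \<Rightarrow> real"
  assumes "open U" "continuous_on U h" "\<And>p. p \<in> U \<Longrightarrow> 0 \<le> h p"
    and "h integrable_on U" "integral U h = 0" "p \<in> U"
  shows "h p = 0"
proof -
  obtain a b where ab: "cbox a b \<subseteq> U" "p \<in> box a b"
    using \<open>open U\<close> \<open>p \<in> U\<close> by (meson open_contains_cbox)
  have cont: "continuous_on (cbox a b) h"
    using ab(1) assms(2) by (rule continuous_on_subset[rotated])
  have "integral (cbox a b) h \<le> integral U h"
    using ab assms integrable_continuous[OF cont] by (intro integral_subset_le) auto
  moreover have "0 \<le> integral (cbox a b) h"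
    using ab assms integrable_continuous[OF cont] by (intro integral_nonneg) auto
  ultimately have "integral (cbox a b) h = 0"
    using assms by simp
  moreover have "box a b \<noteq> {}" using ab by auto
  ultimately have "\<forall>q\<in>cbox a b. h q = 0"
    using integral_cbox_eq_0_iff[OF cont] ab assms by blast
  then show ?thesis using ab box_subset_cbox by blast
qed

section \<open>Coordinate expressions and tangent vectors\<close>

locale smooth_atlas =
  fixes X :: "'a topology" and A :: "('a, 'e::euclidean_space) chart set"
  assumes manifold: "smooth_manifold X A"
begin

lemma chart: "c \<in> A \<Longrightarrow> is_chart X c"
  using manifold by (simp add: smooth_manifold_def)

lemma cdom_subset: "c \<in> A \<Longrightarrow> cdom c \<subseteq> topspace X"
  using chart[of c] by (simp add: is_chart_def openin_subset)

lemma chart_inj: "c \<in> A \<Longrightarrow> inj_on (cmap c) (cdom c)"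
  using chart[of c] cdom_subset[of c] homeomorphic_imp_injective_map
  by (fastforce simp: is_chart_def Int_absorb1)

lemma cinv_cmap [simp]: "c \<in> A \<Longrightarrow> x \<in> cdom c \<Longrightarrow> cinv c (cmap c x) = x"
  by (simp add: cinv_def chart_inj)

lemma cmap_cinv [simp]: "p \<in> cmap c ` cdom c \<Longrightarrow> cmap c (cinv c p) = p"
  by (simp add: cinv_def f_inv_into_f)

lemma cinv_in [simp]: "p \<in> cmap c ` cdom c \<Longrightarrow> cinv c p \<in> cdom c"
  by (simp add: cinv_def inv_into_into)

lemma open_cmap_image:
  assumes "c \<in> A" "openin X W"
  shows "open (cmap c ` (cdom c \<inter> W))"
proof -
  have "openin (top_of_set (cmap c ` cdom c)) (cmap c ` (cdom c \<inter> W))"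
    using chart[OF assms(1)] assms(2) unfolding is_chart_def
    by (meson homeomorphic_imp_open_map open_map_def openin_subtopology_Int2)
  then show ?thesis
    using chart[OF assms(1)] by (auto simp: is_chart_def intro: openin_open_trans)
qed

text \<open>Rewrites preimages under \<^const>\<open>cinv\<close>, which is meaningful only on the image of the chart,
  as direct images under the chart, which are known to be open.\<close>

lemma cinv_vimage:
  assumes "c \<in> A"
  shows "{p \<in> cmap c ` cdom c. cinv c p \<in> W} = cmap c ` (cdom c \<inter> W)"
  using assms by force

lemma openin_cmap_vimage:
  assumes c: "c \<in> A" and "open B"
  shows "openin X {z \<in> cdom c. cmap c z \<in> B}"
proof -
  have "continuous_map (subtopology X (cdom c)) euclidean (cmap c)"
    using chart[OF c] unfolding is_chart_def
    by (meson continuous_map_into_fulltopology homeomorphic_imp_continuous_map)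
  from openin_continuous_map_preimage[OF this, of B]
  have "openin (subtopology X (cdom c)) {z \<in> cdom c. cmap c z \<in> B}"
    using \<open>open B\<close> cdom_subset[OF c] by (simp add: Int_absorb1)
  then show ?thesis
    using chart[OF c] by (auto simp: is_chart_def intro: openin_trans_full)
qed

abbreviation coord :: "('a, 'e) chart \<Rightarrow> ('a, 'e) chart \<Rightarrow> ('a \<Rightarrow> 'a) \<Rightarrow> 'e \<Rightarrow> 'e" where
  "coord c d h \<equiv> cmap d \<circ> h \<circ> cinv c"

abbreviation Dcoord :: "('a, 'e) chart \<Rightarrow> ('a, 'e) chart \<Rightarrow> ('a \<Rightarrow> 'a) \<Rightarrow> 'a \<Rightarrow> 'e \<Rightarrow> 'e" where
  "Dcoord c d h x \<equiv> frechet_derivative (coord c d h) (at (cmap c x))"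

lemma smooth_on_differentiable: "smooth_on W F \<Longrightarrow> p \<in> W \<Longrightarrow> F differentiable (at p)"
  by (simp add: smooth_on_def) (drule spec[of _ "Suc 0"], simp)

text \<open>Transition maps are the coordinate expressions of the identity. The facts below about coordinate
  expressions of smooth maps thus cover transition maps as well.\<close>

lemma smooth_map_id: "smooth_map X A X A id"
proof -
  have "smooth_on (cmap c ` (cdom c \<inter> cdom d)) (cmap d \<circ> cinv c)" if "c \<in> A" "d \<in> A" for c d
    using manifold that by (auto simp: smooth_manifold_def compatible_def)
  then show ?thesis
    by (simp add: smooth_map_def)
qed

lemma coord_differentiable:
  assumes "smooth_map X A X A h" "c \<in> A" "d \<in> A" "x \<in> cdom c" "h x \<in> cdom d"
  shows "coord c d h differentiable (at (cmap c x))"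
  using assms by (intro smooth_on_differentiable[of "cmap c ` (cdom c \<inter> h -` cdom d)"])
    (auto simp: smooth_map_def)

text \<open>Coordinate expressions compose only where the intermediate point stays inside the chosen chart.
  This holds near the base point, which is all that derivatives see.\<close>

lemma eventually_coord:
  assumes h: "continuous_map X X h" and "c \<in> A" "openin X W" "x \<in> cdom c" "h x \<in> W"
  shows "\<forall>\<^sub>F p in at (cmap c x). p \<in> cmap c ` cdom c \<and> h (cinv c p) \<in> W"
proof -
  let ?W = "{z \<in> topspace X. h z \<in> W}"
  have "openin X ?W"
    using h \<open>openin X W\<close> by (rule openin_continuous_map_preimage)
  then have "open (cmap c ` (cdom c \<inter> ?W))"
    by (rule open_cmap_image[OF \<open>c \<in> A\<close>])
  moreover have "cmap c x \<in> cmap c ` (cdom c \<inter> ?W)"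
    using assms cdom_subset by blast
  ultimately have "\<forall>\<^sub>F p in at (cmap c x). p \<in> cmap c ` (cdom c \<inter> ?W)"
    using eventually_at_topological by blast
  then show ?thesis
    by eventually_elim (use \<open>c \<in> A\<close> in auto)
qed

lemma Dcoord_compose:
  assumes h: "smooth_map X A X A h" and k: "smooth_map X A X A k"
    and c: "c \<in> A" "x \<in> cdom c" and d: "d \<in> A" "k x \<in> cdom d" and e: "e \<in> A" "h (k x) \<in> cdom e"
  shows "Dcoord c e (h \<circ> k) x w = Dcoord d e h (k x) (Dcoord c d k x w)"
proof -
  let ?p = "cmap c x"
  have dk: "coord c d k differentiable (at ?p)"
    using k c d by (intro coord_differentiable)
  have p: "coord c d k ?p = cmap d (k x)"
    using c by simp
  have dh: "coord d e h differentiable (at (coord c d k ?p))"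
    unfolding p using h d e by (intro coord_differentiable)
  have "(coord d e h \<circ> coord c d k has_derivative
      frechet_derivative (coord d e h \<circ> coord c d k) (at ?p)) (at ?p)"
    using differentiable_chain_at[OF dk dh] by (simp only: frechet_derivative_works)
  moreover have "\<forall>\<^sub>F q in at ?p. (coord d e h \<circ> coord c d k) q = coord c e (h \<circ> k) q"
    using eventually_coord[of k c "cdom d" x] k c d chart[OF d(1)]
    by (auto simp: smooth_map_def is_chart_def elim!: eventually_mono)
  ultimately have "(coord c e (h \<circ> k) has_derivative
      frechet_derivative (coord d e h \<circ> coord c d k) (at ?p)) (at ?p)"
    by (rule has_derivative_transform_eventually) (use c d in auto)
  then have "Dcoord c e (h \<circ> k) x = frechet_derivative (coord d e h \<circ> coord c d k) (at ?p)"
    by (metis frechet_derivative_at)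
  also have "\<dots> = Dcoord d e h (k x) \<circ> Dcoord c d k x"
    unfolding frechet_derivative_compose[OF dk dh] p ..
  finally show ?thesis
    by (rule fun_cong[THEN trans]) (rule comp_apply)
qed

lemma linear_Dcoord:
  assumes "smooth_map X A X A h" "c \<in> A" "d \<in> A" "x \<in> cdom c" "h x \<in> cdom d"
  shows "linear (Dcoord c d h x)"
  by (rule linear_frechet_derivative[OF coord_differentiable[OF assms]])

lemma tvec_of_coord_in_tangent_space:
  assumes c: "c \<in> A" "x \<in> cdom c"
  shows "tvec_of_coord A c x w \<in> tangent_space A x"
proof -
  have "tvec_of_coord A c x w e
      = frechet_derivative (cmap e \<circ> cinv d) (at (cmap d x)) (tvec_of_coord A c x w d)"
    if "d \<in> charts_at A x" "e \<in> charts_at A x" for d e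
    using Dcoord_compose[OF smooth_map_id smooth_map_id c, of d e w] that
    by (simp add: tvec_of_coord_def charts_at_def)
  moreover have "tvec_of_coord A c x w d = 0" if "d \<notin> charts_at A x" for d
    using that by (simp add: tvec_of_coord_def)
  ultimately show ?thesis
    unfolding tangent_space_def by blast
qed

lemma tangent_space_cases:
  assumes v: "v \<in> tangent_space A x" and c: "c \<in> A" "x \<in> cdom c"
  shows "v = tvec_of_coord A c x (v c)"
proof
  fix d
  have "c \<in> charts_at A x" using c by (simp add: charts_at_def)
  with v have "d \<in> charts_at A x \<Longrightarrow> v d = frechet_derivative (cmap d \<circ> cinv c) (at (cmap c x)) (v c)"
    and "d \<notin> charts_at A x \<Longrightarrow> v d = 0"
    unfolding tangent_space_def by blast+
  then show "v d = tvec_of_coord A c x (v c) d"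
    unfolding tvec_of_coord_def by presburger
qed

lemma tvec_of_coord_linear:
  assumes c: "c \<in> A" "x \<in> cdom c"
  shows "tvec_of_coord A c x (r *\<^sub>R u + s *\<^sub>R w) =
    (\<lambda>d. r *\<^sub>R tvec_of_coord A c x u d + s *\<^sub>R tvec_of_coord A c x w d)"
proof -
  have "linear (Dcoord c d id x)" if "d \<in> charts_at A x" for d
    using that c by (intro linear_Dcoord smooth_map_id) (auto simp: charts_at_def)
  then show ?thesis
    by (intro ext) (simp add: tvec_of_coord_def linear_add linear_cmul)
qed

lemma differential_tvec_of_coord:
  assumes h: "smooth_map X A X A h" and c: "c \<in> A" "x \<in> cdom c" and d: "d \<in> A" "h x \<in> cdom d"
  shows "differential A A h x (tvec_of_coord A c x w) = tvec_of_coord A d (h x) (Dcoord c d h x w)"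
proof
  fix e
  define b where "b = (SOME b. b \<in> charts_at A x)"
  have "c \<in> charts_at A x" using c by (simp add: charts_at_def)
  then have b_at: "b \<in> charts_at A x" unfolding b_def by (rule someI)
  then have b: "b \<in> A" "x \<in> cdom b" by (auto simp: charts_at_def)
  show "differential A A h x (tvec_of_coord A c x w) e = tvec_of_coord A d (h x) (Dcoord c d h x w) e"
  proof (cases "e \<in> charts_at A (h x)")
    case True
    then have e: "e \<in> A" "h x \<in> cdom e" by (auto simp: charts_at_def)
    have "Dcoord b e h x (Dcoord c b id x w) = Dcoord c e h x w"
      using Dcoord_compose[OF h smooth_map_id c, of b e w] b e by simp
    also have "\<dots> = Dcoord d e id (h x) (Dcoord c d h x w)"
      using Dcoord_compose[OF smooth_map_id h c d, of e w] e by simp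
    finally show ?thesis
      using True b_at by (simp add: differential_def Let_def tvec_of_coord_def flip: b_def)
  qed (simp add: differential_def tvec_of_coord_def)
qed

text \<open>The differential of a map preserving \<open>S\<close> is tangent to \<open>S\<close>. Move from the base point
  in the direction \<open>v\<close> along the straight line in \<open>V\<close>: in the chart \<open>c\<close> it lies on \<open>S\<close>, so its image
  stays in \<open>W\<close> for small times, and hence so does the velocity at time \<open>0\<close>. Membership
  in \<open>W\<close> is tested against the orthogonal complement, which turns it into the vanishing of scalar
  derivatives. With the identity for \<open>h\<close>, this says that the tangent space of \<open>S\<close> does not depend
  on the slice chart.\<close>

lemma Dcoord_slice:
  assumes h: "smooth_map X A X A h" "h ` S \<subseteq> S"
    and c: "slice_chart A S c V" "x \<in> cdom c" "x \<in> S"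
    and d: "slice_chart A S d W" "h x \<in> cdom d" and v: "v \<in> V"
  shows "Dcoord c d h x v \<in> W"
proof -
  have cA: "c \<in> A" and V: "subspace V" and cV: "cmap c ` (cdom c \<inter> S) = cmap c ` cdom c \<inter> V"
    and dA: "d \<in> A" and W: "subspace W" and dW: "cmap d ` (cdom d \<inter> S) = cmap d ` cdom d \<inter> W"
    using c(1) d(1) by (auto simp: slice_chart_def)
  let ?p = "cmap c x" and ?F = "coord c d h" and ?D = "Dcoord c d h x"
  let ?\<gamma> = "\<lambda>t::real. ?p + t *\<^sub>R v"
  have pV: "?p \<in> V" using cV c by blast
  have \<gamma>: "(?\<gamma> \<longlongrightarrow> ?p) (at 0)"
    by (auto intro!: tendsto_eq_intros)
  have "\<forall>\<^sub>F q in nhds ?p. q \<in> cmap c ` cdom c \<and> h (cinv c q) \<in> cdom d"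
    using eventually_coord[of h c "cdom d" x] chart[OF dA] h cA c d
    by (auto simp: eventually_nhds_conv_at smooth_map_def is_chart_def)
  from eventually_compose_filterlim[OF this \<gamma>]
  have in_W: "\<forall>\<^sub>F t in at 0. ?F (?\<gamma> t) \<in> W"
  proof eventually_elim
    case (elim t)
    have "?\<gamma> t \<in> V"
      using V pV v by (simp add: subspace_add subspace_scale)
    then have "?\<gamma> t \<in> cmap c ` (cdom c \<inter> S)"
      using elim cV by blast
    then have "cinv c (?\<gamma> t) \<in> S"
      using cA by auto
    then have "?F (?\<gamma> t) \<in> cmap d ` (cdom d \<inter> S)"
      using h(2) elim by auto
    then show ?case using dW by blast
  qed
  have FW: "?F ?p \<in> W"
    using dW h(2) cA c d by auto
  \<comment> \<open>A subspace of a Euclidean space is its own double orthogonal complement.\<close>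
  have "?D v \<in> orthogonal_comp (orthogonal_comp W)"
  proof -
    have "y \<bullet> ?D v = 0" if y: "y \<in> orthogonal_comp W" for y
    proof -
      have y0: "y \<bullet> z = 0" if "z \<in> W" for z
        using y that by (auto simp: orthogonal_comp_def orthogonal_def inner_commute)
      have "(?F has_derivative ?D) (at (?\<gamma> 0))"
        using coord_differentiable[OF h(1) cA dA c(2) d(2)] by (simp add: frechet_derivative_works)
      moreover have "(?\<gamma> has_derivative (\<lambda>t. t *\<^sub>R v)) (at 0)"
        by (auto intro!: derivative_eq_intros)
      ultimately have "((\<lambda>t. ?F (?\<gamma> t)) has_derivative (\<lambda>t. ?D (t *\<^sub>R v))) (at 0)"
        by (rule has_derivative_compose[rotated])
      then have "((\<lambda>t. y \<bullet> ?F (?\<gamma> t)) has_derivative (\<lambda>t. y \<bullet> ?D (t *\<^sub>R v))) (at 0)"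
        by (rule has_derivative_inner_right)
      moreover have "\<forall>\<^sub>F t in at 0. y \<bullet> ?F (?\<gamma> t) = 0"
        using in_W by eventually_elim (rule y0)
      ultimately have "((\<lambda>t. 0) has_derivative (\<lambda>t. y \<bullet> ?D (t *\<^sub>R v))) (at 0)"
        by (rule has_derivative_transform_eventually) (use FW y0 in auto)
      from has_derivative_unique[OF this has_derivative_const]
      have "y \<bullet> ?D (1 *\<^sub>R v) = 0" by (rule fun_cong)
      then show ?thesis by simp
    qed
    then show ?thesis by (simp add: orthogonal_comp_def orthogonal_def)
  qed
  then show ?thesis
    using W by (simp add: orthogonal_comp_self)
qed

end

section \<open>Planar coordinates on surfaces\<close>

text \<open>A slice chart for a surface together with a linear isometry \<open>L\<close> from the standard plane onto the
  flattened surface and a linear left inverse \<open>R\<close> of \<open>L\<close>. The change of variables theorem is about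
  maps of \<open>real^2\<close>, so surface coordinates have to live there instead of in a subspace of the
  model space. Defining \<open>R\<close> on the whole model space makes the coordinate expressions of maps
  between surfaces, which have the form \<open>R \<circ> F \<circ> L\<close>, differentiable without restriction to subspaces.\<close>

definition planar_chart ::
    "('a, 'e::euclidean_space) chart set \<Rightarrow> 'a set \<Rightarrow> ('a, 'e) chart \<Rightarrow>
     (real^2 \<Rightarrow> 'e) \<Rightarrow> ('e \<Rightarrow> real^2) \<Rightarrow> bool" where
  "planar_chart A S c L R \<longleftrightarrow>
     slice_chart A S c (range L) \<and> linear L \<and> linear R \<and> (\<forall>p. norm (L p) = norm p \<and> R (L p) = p)"

lemma planar_chart_exists:
  fixes V :: "'e::euclidean_space set"
  assumes "slice_chart A S c V" "dim V = 2"
  shows "\<exists>L R. planar_chart A S c L R"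
proof -
  have "subspace V" using assms by (simp add: slice_chart_def)
  have "dim (UNIV :: (real^2) set) = dim V"
    using assms(2) by (simp add: dim_UNIV)
  from isometries_subspaces[OF subspace_UNIV \<open>subspace V\<close> this]
  obtain L :: "real^2 \<Rightarrow> 'e" and R where "linear L" "linear R" "L ` UNIV = V"
    "\<And>p. norm (L p) = norm p" "\<And>p. R (L p) = p"
    by (metis UNIV_I)
  then show ?thesis
    using assms by (auto simp: planar_chart_def)
qed

context smooth_atlas
begin

lemma planar_chart_coord:
  assumes "planar_chart A S c L R" "z \<in> cdom c" "z \<in> S"
  shows "L (R (cmap c z)) = cmap c z"
proof -
  have "cmap c z \<in> range L"
    using assms by (auto simp: planar_chart_def slice_chart_def)
  then show ?thesis using assms by (auto simp: planar_chart_def)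
qed

lemma planar_chart_param:
  assumes pc: "planar_chart A S c L R" and p: "L p \<in> cmap c ` cdom c"
  shows "cinv c (L p) \<in> S"
proof -
  have "L p \<in> cmap c ` (cdom c \<inter> S)" "c \<in> A"
    using assms by (auto simp: planar_chart_def slice_chart_def)
  then show ?thesis by auto
qed

lemma planar_chart_open:
  assumes pc: "planar_chart A S c L R" and W: "openin X W"
  shows "open {p. L p \<in> cmap c ` cdom c \<and> cinv c (L p) \<in> W}"
proof -
  have c: "c \<in> A" and L: "linear L"
    using pc by (auto simp: planar_chart_def slice_chart_def)
  have "open (L -` (cmap c ` (cdom c \<inter> W)))"
    using open_cmap_image[OF c W] linear_continuous_on[of L UNIV] L
    by (simp add: linear_conv_bounded_linear open_vimage)
  also have "L -` (cmap c ` (cdom c \<inter> W)) = {p. L p \<in> cmap c ` cdom c \<and> cinv c (L p) \<in> W}"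
    unfolding cinv_vimage[OF c, symmetric] by auto
  finally show ?thesis .
qed

end

section \<open>Forms contracted by a map\<close>

locale contracted_form = smooth_atlas X A
  for X :: "'a topology" and A :: "('a, 'e::euclidean_space) chart set" +
  fixes \<omega> :: "('a, 'e) form2" and f :: "'a \<Rightarrow> 'a" and a :: real
  assumes form: "smooth_2form X A \<omega>"
    and f_smooth: "smooth_map X A X A f"
    and contracts: "\<And>x u v. x \<in> topspace X \<Longrightarrow> u \<in> tangent_space A x \<Longrightarrow> v \<in> tangent_space A x \<Longrightarrow>
           pullback_form A A f \<omega> x u v = a * \<omega> x u v"
    and factor: "0 < a" "a < 1"
begin

text \<open>The form at the point \<open>x\<close> itself, in the coordinates of \<open>c\<close>; in contrast, \<^const>\<open>form_coord\<close>
  takes the coordinates of the point.\<close>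

definition form_at :: "('a, 'e) chart \<Rightarrow> 'a \<Rightarrow> 'e \<Rightarrow> 'e \<Rightarrow> real" where
  "form_at c x u w = \<omega> x (tvec_of_coord A c x u) (tvec_of_coord A c x w)"

lemma form_at_linear:
  assumes c: "c \<in> A" "x \<in> cdom c"
  shows "linear (\<lambda>u. form_at c x u w)"
proof -
  have x: "x \<in> topspace X" using c cdom_subset by blast
  have *: "form_at c x (r *\<^sub>R u + s *\<^sub>R v) w = r * form_at c x u w + s * form_at c x v w" for r s u v
    using form x tvec_of_coord_in_tangent_space[OF c]
    unfolding form_at_def tvec_of_coord_linear[OF c] smooth_2form_def by blast
  show ?thesis
    using *[of 1 _ 1] *[of _ _ 0] by (intro linearI) simp_all
qed

lemma form_at_alternating:
  assumes c: "c \<in> A" "x \<in> cdom c"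
  shows "form_at c x u w = - form_at c x w u"
proof -
  have "x \<in> topspace X" using c cdom_subset by blast
  then show ?thesis
    using form tvec_of_coord_in_tangent_space[OF c] unfolding form_at_def smooth_2form_def by blast
qed

lemma form_at_contracts:
  assumes c: "c \<in> A" "x \<in> cdom c" and d: "d \<in> A" "f x \<in> cdom d"
  shows "form_at d (f x) (Dcoord c d f x u) (Dcoord c d f x w) = a * form_at c x u w"
proof -
  have "x \<in> topspace X" using c cdom_subset by blast
  from contracts[OF this tvec_of_coord_in_tangent_space[OF c] tvec_of_coord_in_tangent_space[OF c]]
  show ?thesis
    by (simp only: form_at_def pullback_form_def differential_tvec_of_coord[OF f_smooth c d])
qed

text \<open>The density, with respect to Lebesgue measure on the parameter plane, of the area measure that
  the absolute value of the 2-form induces on the surface.\<close>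

definition area_density :: "('a, 'e) chart \<Rightarrow> (real^2 \<Rightarrow> 'e) \<Rightarrow> real^2 \<Rightarrow> real" where
  "area_density c L p = \<bar>form_at c (cinv c (L p)) (L (axis 1 1)) (L (axis 2 1))\<bar>"

lemma continuous_on_area_density:
  assumes pc: "planar_chart A S c L R"
  shows "continuous_on {p. L p \<in> cmap c ` cdom c} (area_density c L)"
proof -
  have c: "c \<in> A" and L: "linear L"
    using pc by (auto simp: planar_chart_def slice_chart_def)
  have "C_diff 0 (cmap c ` cdom c) (\<lambda>q. form_coord A \<omega> c q (L (axis 1 1)) (L (axis 2 1)))"
    using form c unfolding smooth_2form_def smooth_on_def by blast
  then have "continuous_on (cmap c ` cdom c) (\<lambda>q. form_coord A \<omega> c q (L (axis 1 1)) (L (axis 2 1)))"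
    by simp
  then have "continuous_on {p. L p \<in> cmap c ` cdom c}
      (\<lambda>p. form_coord A \<omega> c (L p) (L (axis 1 1)) (L (axis 2 1)))"
    by (rule continuous_on_compose2)
      (auto simp: L linear_continuous_on linear_conv_bounded_linear[symmetric])
  then have "continuous_on {p. L p \<in> cmap c ` cdom c}
      (\<lambda>p. \<bar>form_coord A \<omega> c (L p) (L (axis 1 1)) (L (axis 2 1))\<bar>)"
    by (rule continuous_on_rabs)
  then show ?thesis
    by (simp add: area_density_def[abs_def] form_at_def form_coord_def)
qed

lemma form_at_plane_alternating:
  assumes pc: "planar_chart A S c L R" and x: "x \<in> cdom c"
  shows "linear (\<lambda>s. form_at c x (L s) (L t))" "form_at c x (L s) (L t) = - form_at c x (L t) (L s)"
proof -
  have c: "c \<in> A" and L: "linear L"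
    using pc by (auto simp: planar_chart_def slice_chart_def)
  show "linear (\<lambda>s. form_at c x (L s) (L t))"
    using linear_compose[OF L form_at_linear[OF c x]] by (simp add: o_def)
  show "form_at c x (L s) (L t) = - form_at c x (L t) (L s)"
    by (rule form_at_alternating[OF c x])
qed

text \<open>\<open>T\<close> is the derivative of \<open>f\<close> restricted to the surface, in planar coordinates. The relation
  \<open>L' \<circ> T = DF \<circ> L\<close>, where \<open>DF\<close> is the derivative in the coordinates of the ambient manifold, holds
  because \<open>DF\<close> preserves tangency to \<open>S\<close>. Evaluating the form on the images of the two basis
  vectors therefore gives \<open>det T\<close> times the density at the image point, while the hypothesis on \<open>f\<close>
  gives \<open>a\<close> times the density at the original point.\<close>

lemma area_density_transforms:
  assumes fS: "f ` S \<subseteq> S"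
    and pc: "planar_chart A S c L R" and pd: "planar_chart A S d L' R'"
    and p: "L p \<in> cmap c ` cdom c" and fp: "f (cinv c (L p)) \<in> cdom d"
  defines "G \<equiv> \<lambda>q. R' (coord c d f (L q))"
    and "T \<equiv> \<lambda>s. R' (Dcoord c d f (cinv c (L p)) (L s))"
  shows "(G has_derivative T) (at p)"
    and "L' (G p) = cmap d (f (cinv c (L p)))"
    and "\<bar>det (matrix T)\<bar> * area_density d L' (G p) = a * area_density c L p"
proof -
  let ?x = "cinv c (L p)" and ?e1 = "axis 1 1 :: real^2" and ?e2 = "axis 2 1 :: real^2"
  have c: "c \<in> A" "slice_chart A S c (range L)" and L: "linear L"
    and d: "d \<in> A" "slice_chart A S d (range L')" and R': "linear R'" "\<And>q. R' (L' q) = q"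
    using pc pd by (auto simp: planar_chart_def slice_chart_def)
  have x: "?x \<in> cdom c" "?x \<in> S" and Lp: "cmap c ?x = L p"
    using p planar_chart_param[OF pc p] by auto
  have fx: "f ?x \<in> S" using x fS by auto
  have "(coord c d f has_derivative Dcoord c d f ?x) (at (L p))"
    using coord_differentiable[OF f_smooth c(1) d(1) x(1) fp]
    unfolding frechet_derivative_works Lp .
  with linear_imp_has_derivative[OF L]
  have "((\<lambda>q. coord c d f (L q)) has_derivative (\<lambda>s. Dcoord c d f ?x (L s))) (at p)"
    by (rule has_derivative_compose)
  from has_derivative_compose[OF this linear_imp_has_derivative[OF R'(1)]]
  show "(G has_derivative T) (at p)"
    unfolding G_def T_def .
  show LG: "L' (G p) = cmap d (f ?x)"
    unfolding G_def using planar_chart_coord[OF pd fp fx] by simp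
  have LT: "L' (T s) = Dcoord c d f ?x (L s)" for s
  proof -
    have "Dcoord c d f ?x (L s) \<in> range L'"
      by (rule Dcoord_slice[OF f_smooth fS c(2) x d(2) fp]) simp
    then show ?thesis unfolding T_def by (auto simp: R'(2))
  qed
  have "det (matrix T) * form_at d (f ?x) (L' ?e1) (L' ?e2) = form_at d (f ?x) (L' (T ?e1)) (L' (T ?e2))"
    by (rule alternating_linear_image[symmetric, where \<beta>="\<lambda>s t. form_at d (f ?x) (L' s) (L' t)"])
      (rule form_at_plane_alternating[OF pd fp])+
  also have "\<dots> = a * form_at c ?x (L ?e1) (L ?e2)"
    unfolding LT by (rule form_at_contracts[OF c(1) x(1) d(1) fp])
  finally have "\<bar>det (matrix T)\<bar> * \<bar>form_at d (f ?x) (L' ?e1) (L' ?e2)\<bar>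
      = a * \<bar>form_at c ?x (L ?e1) (L ?e2)\<bar>"
    using factor by (metis abs_mult abs_of_pos)
  then show "\<bar>det (matrix T)\<bar> * area_density d L' (G p) = a * area_density c L p"
    using d fp by (simp add: area_density_def LG)
qed

text \<open>The finitely many patches \<open>N k\<close> cover \<open>S\<close>; subtracting from each patch the earlier ones gives a
  partition of \<open>S\<close> to which the vanishing of the contracted total area applies. The patch with
  index \<open>0\<close> is not diminished, so the density has integral zero over a whole open set, and by
  continuity it is zero there. Any other patch may lose all its interior, which is why the conclusion
  is only about the first one.\<close>

lemma area_density_vanishes:
  fixes c :: "nat \<Rightarrow> ('a, 'e) chart" and B :: "nat \<Rightarrow> 'e set"
  defines "N \<equiv> \<lambda>k. {z \<in> cdom (c k). cmap (c k) z \<in> B k}"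
  assumes S: "f ` S = S" "inj_on f S"
    and pc: "\<And>k. k < n \<Longrightarrow> planar_chart A S (c k) (L k) (R k)"
    and B: "\<And>k. k < n \<Longrightarrow> open (B k)" "\<And>k. k < n \<Longrightarrow> bounded (B k)"
      "\<And>k. k < n \<Longrightarrow> closure (B k) \<subseteq> cmap (c k) ` cdom (c k)"
    and cover: "S \<subseteq> (\<Union>k<n. N k)"
    and "0 < n" and p: "L 0 p \<in> B 0"
  shows "area_density (c 0) (L 0) p = 0"
proof -
  define \<psi> where "\<psi> = (\<lambda>k p. cinv (c k) (L k p))"
  define E where "E = (\<lambda>k W. {p. L k p \<in> cmap (c k) ` cdom (c k) \<and> \<psi> k p \<in> W})"
  define P where "P = (\<lambda>k. E k (N k - (\<Union>j<k. N j)))"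
  let ?h = "\<lambda>k. area_density (c k) (L k)"
  have cA: "c k \<in> A" and Lin: "linear (L k)" and RL: "R k (L k q) = q" and norm: "norm (L k q) = norm q"
    if "k < n" for k q
    using pc[OF that] by (auto simp: planar_chart_def slice_chart_def)
  have img: "B k \<subseteq> cmap (c k) ` cdom (c k)" if "k < n" for k
    using B(3)[OF that] closure_subset[of "B k"] by blast
  have N_open: "openin X (N k)" if "k < n" for k
    unfolding N_def using cA B that by (intro openin_cmap_vimage) auto
  have E_meas: "E k W \<in> sets lebesgue" if "k < n" "openin X W" for k W
  proof -
    have "open (E k W)"
      unfolding E_def \<psi>_def by (rule planar_chart_open[OF pc]) fact+
    then show ?thesis by simp
  qed
  have E_diff: "E k (U - (\<Union>j<m. V j)) = E k U - (\<Union>j<m. E k (V j))" for k m :: nat and U V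
    by (auto simp: E_def)
  have P_meas: "P k \<in> sets lebesgue" if "k < n" for k
    unfolding P_def E_diff using that by (intro sets.Diff sets.finite_UN E_meas N_open) auto
  have P_iff: "q \<in> P k \<longleftrightarrow> L k q \<in> B k \<and> \<psi> k q \<notin> (\<Union>j<k. N j)" if "k < n" for k q
    using img[OF that] by (auto simp: P_def E_def N_def \<psi>_def)
  have image: "\<psi> k ` P k = S \<inter> (N k - (\<Union>j<k. N j))" if k: "k < n" for k
  proof
    show "\<psi> k ` P k \<subseteq> S \<inter> (N k - (\<Union>j<k. N j))"
      using planar_chart_param[OF pc[OF k]] by (auto simp: P_def E_def \<psi>_def)
    show "S \<inter> (N k - (\<Union>j<k. N j)) \<subseteq> \<psi> k ` P k"
    proof
      fix z assume z: "z \<in> S \<inter> (N k - (\<Union>j<k. N j))"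
      then have zc: "z \<in> cdom (c k)" by (simp add: N_def)
      have "L k (R k (cmap (c k) z)) = cmap (c k) z"
        using planar_chart_coord[OF pc[OF k] zc] z by blast
      then have "\<psi> k (R k (cmap (c k) z)) = z" "R k (cmap (c k) z) \<in> P k"
        using z zc cA[OF k] by (simp_all add: P_def E_def \<psi>_def)
      then show "z \<in> \<psi> k ` P k" by (metis imageI)
    qed
  qed
  \<comment> \<open>Finiteness of the total area: the density is continuous on the closed patch, which lies inside the chart.\<close>
  have int: "?h k absolutely_integrable_on P k" if k: "k < n" for k
  proof -
    let ?K = "{q. L k q \<in> closure (B k)}"
    have "compact ?K"
    proof (rule compact_eq_bounded_closed[THEN iffD2], intro conjI)
      have "bounded (closure (B k))" using B(2)[OF k] by (rule bounded_closure)
      then obtain b where "\<And>v. v \<in> closure (B k) \<Longrightarrow> norm v \<le> b"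
        unfolding bounded_iff by blast
      then show "bounded ?K" using norm[OF k] by (intro boundedI[of _ b]) (metis mem_Collect_eq)
      have "closed (L k -` closure (B k))"
        using Lin[OF k] by (intro closed_vimage linear_continuous_on)
          (auto simp: linear_conv_bounded_linear)
      then show "closed ?K" by (simp add: vimage_def)
    qed
    moreover have "continuous_on ?K (?h k)"
      by (rule continuous_on_subset[OF continuous_on_area_density[OF pc[OF k]]]) (use B(3)[OF k] in auto)
    moreover have "P k \<subseteq> ?K"
      using P_iff[OF k] closure_subset[of "B k"] by blast
    ultimately show ?thesis
      using P_meas[OF k] by (intro absolutely_integrable_compact_subset)
  qed
  define Q where "Q = (\<lambda>k l. {q \<in> P k. f (\<psi> k q) \<in> \<psi> l ` P l})"
  have Q: "L k q \<in> cmap (c k) ` cdom (c k)" "f (\<psi> k q) \<in> cdom (c l)"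
      "f (\<psi> k q) \<in> S \<inter> (N l - (\<Union>j<l. N j))" if "l < n" "q \<in> Q k l" for k l q
  proof -
    have q: "q \<in> P k" "f (\<psi> k q) \<in> \<psi> l ` P l" using that by (simp_all add: Q_def)
    show "f (\<psi> k q) \<in> S \<inter> (N l - (\<Union>j<l. N j))" using q(2) unfolding image[OF that(1)] .
    then have "f (\<psi> k q) \<in> N l" by (rule IntD2[THEN DiffD1])
    then show "f (\<psi> k q) \<in> cdom (c l)" by (simp add: N_def)
    show "L k q \<in> cmap (c k) ` cdom (c k)" using q(1) unfolding P_def E_def by blast
  qed
  have inj: "inj_on (\<psi> k) (P k)" if k: "k < n" for k
  proof (rule inj_onI)
    fix q r assume "q \<in> P k" "r \<in> P k" and eq: "\<psi> k q = \<psi> k r"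
    then have "L k q \<in> cmap (c k) ` cdom (c k)" "L k r \<in> cmap (c k) ` cdom (c k)"
      unfolding P_def E_def by blast+
    then have "L k q = L k r"
      using eq unfolding \<psi>_def by (metis cmap_cinv)
    then show "q = r" using RL[OF k] by metis
  qed
  have disj: "\<psi> k ` P k \<inter> \<psi> l ` P l = {}" if "k < n" "l < n" "k \<noteq> l" for k l
    unfolding image[OF that(1)] image[OF that(2)] using that(3) nat_neq_iff[of k l] by blast
  have union: "(\<Union>k<n. \<psi> k ` P k) = S"
  proof
    show "(\<Union>k<n. \<psi> k ` P k) \<subseteq> S" using image by blast
    show "S \<subseteq> (\<Union>k<n. \<psi> k ` P k)"
    proof
      fix z assume z: "z \<in> S"
      then obtain k where k: "k < n" "z \<in> N k" using cover by blast
      \<comment> \<open>The first patch that contains the point is the one whose piece it ends up in.\<close>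
      then obtain m where m: "z \<in> N m" "\<forall>j<m. z \<notin> N j"
        using exists_least_iff[of "\<lambda>k. z \<in> N k"] by blast
      then have "m < n" using k by (metis linorder_neqE_nat order.strict_trans)
      moreover have "z \<in> \<psi> m ` P m"
        unfolding image[OF \<open>m < n\<close>] using m z by simp
      ultimately show "z \<in> (\<Union>k<n. \<psi> k ` P k)" by blast
    qed
  qed
  \<comment> \<open>The condition \<open>f (\<psi> k q) \<in> S\<close> holds automatically, so only open patches have to be pulled back.\<close>
  have Q_meas: "Q k l \<in> sets lebesgue" if k: "k < n" and l: "l < n" for k l
  proof -
    let ?F = "\<lambda>j. {z \<in> topspace X. f z \<in> N j}"
    have F_open: "openin X (?F j)" if "j < n" for j
      using f_smooth N_open[OF that] by (auto simp: smooth_map_def openin_continuous_map_preimage)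
    have "Q k l = P k \<inter> E k (?F l - (\<Union>j<l. ?F j))"
    proof -
      have "(f (\<psi> k q) \<in> \<psi> l ` P l) \<longleftrightarrow> q \<in> E k (?F l - (\<Union>j<l. ?F j))" if q: "q \<in> P k" for q
      proof -
        have "\<psi> k q \<in> S" "\<psi> k q \<in> cdom (c k)"
          using imageI[OF q, of "\<psi> k"] unfolding image[OF k] by (simp_all add: N_def)
        moreover from this have "f (\<psi> k q) \<in> S" "\<psi> k q \<in> topspace X"
          using S(1) cdom_subset[OF cA[OF k]] by blast+
        moreover have "L k q \<in> cmap (c k) ` cdom (c k)"
          using q unfolding P_def E_def by blast
        ultimately show ?thesis
          unfolding image[OF l] E_def by simp
      qed
      then show ?thesis
        unfolding Q_def by (intro set_eqI) (simp only: mem_Collect_eq Int_iff cong: conj_cong)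
    qed
    also have "\<dots> \<in> sets lebesgue"
      unfolding E_diff using k l
      by (intro sets.Int sets.Diff sets.finite_UN E_meas F_open P_meas) auto
    finally show ?thesis .
  qed
  let ?G = "\<lambda>k l q. R l (coord (c k) (c l) f (L k q))"
  let ?T = "\<lambda>k l q s. R l (Dcoord (c k) (c l) f (\<psi> k q) (L k s))"
  have trans: "(?G k l has_derivative ?T k l q) (at q)"
      "?G k l q \<in> P l \<and> \<psi> l (?G k l q) = f (\<psi> k q)"
      "\<bar>det (matrix (?T k l q))\<bar> * ?h l (?G k l q) = a * ?h k q"
    if k: "k < n" and l: "l < n" and q: "q \<in> Q k l" for k l q
  proof -
    note Qq = Q[OF l q]
    have fS: "f ` S \<subseteq> S" using S by simp
    have fq: "f (cinv (c k) (L k q)) \<in> cdom (c l)" using Qq(2) by (simp add: \<psi>_def)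
    note T = area_density_transforms[OF fS pc[OF k] pc[OF l] Qq(1) fq]
    show "(?G k l has_derivative ?T k l q) (at q)"
      using T(1) by (simp add: \<psi>_def)
    have "L l (?G k l q) = cmap (c l) (f (\<psi> k q))"
      using T(2) by (simp add: \<psi>_def)
    then have "\<psi> l (?G k l q) = f (\<psi> k q)" "L l (?G k l q) \<in> cmap (c l) ` cdom (c l)"
      using Qq(2) cA[OF l] by (simp_all add: \<psi>_def)
    then show "?G k l q \<in> P l \<and> \<psi> l (?G k l q) = f (\<psi> k q)"
      using Qq(3) by (simp add: P_def E_def)
    show "\<bar>det (matrix (?T k l q))\<bar> * ?h l (?G k l q) = a * ?h k q"
      using T(3) by (simp add: \<psi>_def)
  qed
  have Q_eq: "Q k l = {q \<in> P k. f (\<psi> k q) \<in> \<psi> l ` P l}" for k l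
    by (simp add: Q_def)
  have "(\<Sum>k<n. integral (P k) (?h k)) = 0"
    by (rule contracted_area_vanishes[where f=f and \<psi>=\<psi> and S=S and a=a and G="?G" and G'="?T", OF Q_eq])
      (simp_all only: lessThan_iff finite_lessThan int inj disj union S
        Q_meas trans less_imp_neq[OF factor(2)] not_False_eq_True)
  moreover have "0 \<le> integral (P k) (?h k)" if "k < n" for k
    using int[OF that] by (intro integral_nonneg) (auto simp: absolutely_integrable_on_def area_density_def)
  ultimately have "integral (P 0) (?h 0) = 0"
    using \<open>0 < n\<close> sum_nonneg_eq_0_iff[of "{..<n}" "\<lambda>k. integral (P k) (?h k)"] by auto
  moreover have P0: "P 0 = L 0 -` B 0"
    using P_iff[OF \<open>0 < n\<close>] by auto
  ultimately have int0: "integral (L 0 -` B 0) (?h 0) = 0" by simp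
  have "?h 0 integrable_on L 0 -` B 0"
    using int[OF \<open>0 < n\<close>] P0 by (simp add: absolutely_integrable_on_def)
  moreover have "open (L 0 -` B 0)"
    using Lin[OF \<open>0 < n\<close>] B(1)[OF \<open>0 < n\<close>]
    by (simp add: open_vimage linear_continuous_on linear_conv_bounded_linear)
  moreover have "continuous_on (L 0 -` B 0) (?h 0)"
    by (rule continuous_on_subset[OF continuous_on_area_density[OF pc[OF \<open>0 < n\<close>]]])
      (use img[OF \<open>0 < n\<close>] in auto)
  moreover have "0 \<le> ?h 0 q" "p \<in> L 0 -` B 0" for q
    using p by (simp_all add: area_density_def)
  ultimately show ?thesis
    using int0 zero_integral_on_open[of "L 0 -` B 0" "?h 0" p] by blast
qed

section \<open>Isotropy of invariant closed surfaces\<close>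

text \<open>Compactness provides finitely many patches, each compactly contained in its chart. A patch
  around the given point is put in front of them, to become the undiminished one.\<close>

lemma form_vanishes_on_slice:
  assumes S: "f ` S = S" "inj_on f S" "compactin X S"
    and slices: "\<And>y. y \<in> S \<Longrightarrow> \<exists>c V. slice_chart A S c V \<and> y \<in> cdom c \<and> dim V = 2"
    and x: "x \<in> S"
  obtains c L R where "planar_chart A S c L R" "x \<in> cdom c"
    "area_density c L (R (cmap c x)) = 0"
proof -
  have "\<exists>c L R r. planar_chart A S c L R \<and> y \<in> cdom c \<and> 0 < r \<and>
      cball (cmap c y) r \<subseteq> cmap c ` cdom c" if y: "y \<in> S" for y
  proof -
    obtain c V where c: "slice_chart A S c V" "y \<in> cdom c" "dim V = 2"
      using slices[OF y] by blast
    then have "open (cmap c ` cdom c)"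
      using chart by (auto simp: slice_chart_def is_chart_def)
    then obtain r where "0 < r" "cball (cmap c y) r \<subseteq> cmap c ` cdom c"
      using c(2) by (meson imageI open_contains_cball)
    then show ?thesis
      using planar_chart_exists[OF c(1,3)] c(2) by blast
  qed
  then obtain c L R r where
    pc: "\<And>y. y \<in> S \<Longrightarrow> planar_chart A S (c y) (L y) (R y)" and
    cd: "\<And>y. y \<in> S \<Longrightarrow> y \<in> cdom (c y)" and
    r: "\<And>y. y \<in> S \<Longrightarrow> 0 < r y" "\<And>y. y \<in> S \<Longrightarrow> cball (cmap (c y) y) (r y) \<subseteq> cmap (c y) ` cdom (c y)"
    by metis
  define B where "B = (\<lambda>y. ball (cmap (c y) y) (r y))"
  define N where "N = (\<lambda>y. {z \<in> cdom (c y). cmap (c y) z \<in> B y})"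
  have "openin X (N y)" if "y \<in> S" for y
    using pc[OF that] unfolding N_def B_def
    by (intro openin_cmap_vimage) (auto simp: planar_chart_def slice_chart_def)
  moreover have "S \<subseteq> \<Union> (N ` S)"
  proof
    fix z assume "z \<in> S"
    then have "z \<in> N z" using cd r(1) by (simp add: N_def B_def)
    with \<open>z \<in> S\<close> show "z \<in> \<Union> (N ` S)" by blast
  qed
  ultimately have "\<exists>\<F>. finite \<F> \<and> \<F> \<subseteq> N ` S \<and> S \<subseteq> \<Union> \<F>"
    using \<open>compactin X S\<close> unfolding compactin_def by (simp add: Ball_image_comp)
  then obtain \<F> where \<F>: "finite \<F>" "\<F> \<subseteq> N ` S" "S \<subseteq> \<Union> \<F>"
    by blast
  from finite_subset_image[OF \<F>(1,2)]
  obtain Y where "finite Y" "Y \<subseteq> S" and SY: "S \<subseteq> \<Union> (N ` Y)"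
    using \<F>(3) by blast
  obtain ys where ys: "set ys = Y" using finite_list[OF \<open>finite Y\<close>] by blast
  define y where "y = (\<lambda>k. (x # ys) ! k)"
  have yS: "y k \<in> S" if "k < length (x # ys)" for k
    using nth_mem[OF that] x ys \<open>Y \<subseteq> S\<close> by (auto simp: y_def)
  have Yy: "\<exists>k<length (x # ys). z = y k" if "z \<in> Y" for z
    using that ys by (metis in_set_conv_nth list.set_intros(2) y_def)
  have "area_density (c (y 0)) (L (y 0)) (R (y 0) (cmap (c (y 0)) x)) = 0"
  proof (rule area_density_vanishes[where c="\<lambda>k. c (y k)" and L="\<lambda>k. L (y k)" and R="\<lambda>k. R (y k)"
        and B="\<lambda>k. B (y k)" and n="length (x # ys)" and S=S])
    show "S \<subseteq> (\<Union>k<length (x # ys). {z \<in> cdom (c (y k)). cmap (c (y k)) z \<in> B (y k)})"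
    proof
      fix z assume "z \<in> S"
      then obtain w where w: "w \<in> Y" "z \<in> N w" using SY by blast
      with Yy[of w] show "z \<in> (\<Union>k<length (x # ys). {z \<in> cdom (c (y k)). cmap (c (y k)) z \<in> B (y k)})"
        by (auto simp: N_def)
    qed
    have "L x (R x (cmap (c x) x)) = cmap (c x) x"
      using planar_chart_coord[OF pc[OF x] cd[OF x] x] .
    then show "L (y 0) (R (y 0) (cmap (c (y 0)) x)) \<in> B (y 0)"
      using r(1)[OF x] by (simp add: y_def B_def)
    show "closure (B (y k)) \<subseteq> cmap (c (y k)) ` cdom (c (y k))" if "k < length (x # ys)" for k
      using r[OF yS[OF that]] by (simp add: B_def)
    show "f ` S = S" "inj_on f S" by fact+
    show "planar_chart A S (c (y k)) (L (y k)) (R (y k))" if "k < length (x # ys)" for k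
      by (rule pc[OF yS[OF that]])
    show "open (B (y k))" "bounded (B (y k))" for k
      by (simp_all add: B_def)
    show "0 < length (x # ys)" by simp
  qed
  then show ?thesis
    using that[of "c x" "L x" "R x"] pc[OF x] cd[OF x] by (simp add: y_def)
qed

text \<open>Tangency of the vector may be witnessed by a slice chart other than \<open>c\<close>; the derivative of the
  transition to \<open>c\<close> brings its coordinates into \<open>range L\<close>.\<close>

lemma sub_tangent_space_planar:
  assumes pc: "planar_chart A S c L R" and x: "x \<in> cdom c" "x \<in> S"
    and u: "u \<in> sub_tangent_space A S x"
  obtains s where "u = tvec_of_coord A c x (L s)"
proof -
  have c: "c \<in> A" "slice_chart A S c (range L)"
    using pc by (auto simp: planar_chart_def slice_chart_def)
  obtain d V where d: "slice_chart A S d V" "x \<in> cdom d" "u d \<in> V"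
    and uT: "u \<in> tangent_space A x"
    using u by (auto simp: sub_tangent_space_def)
  have "c \<in> charts_at A x" "d \<in> charts_at A x"
    using c(1) d(1,2) x(1) by (auto simp: charts_at_def slice_chart_def)
  with uT have "u c = frechet_derivative (cmap c \<circ> cinv d) (at (cmap d x)) (u d)"
    unfolding tangent_space_def by blast
  then have "u c = Dcoord d c id x (u d)" by simp
  also have "\<dots> \<in> range L"
    using Dcoord_slice[OF smooth_map_id _ d(1,2) x(2) c(2) _ d(3)] x(1) by simp
  finally obtain s where "u c = L s" by blast
  then show ?thesis
    using that tangent_space_cases[OF uT c(1) x(1)] by simp
qed

lemma isotropic_of_invariant_surface:
  assumes S: "f ` S = S" "inj_on f S" "closed_surface X A S"
  shows "isotropic A \<omega> S"
  unfolding isotropic_def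
proof (intro ballI)
  fix x u v assume x: "x \<in> S" and u: "u \<in> sub_tangent_space A S x" and v: "v \<in> sub_tangent_space A S x"
  have "compactin X S"
    and "\<And>y. y \<in> S \<Longrightarrow> \<exists>c V. slice_chart A S c V \<and> y \<in> cdom c \<and> dim V = 2"
    using S(3) by (simp_all add: closed_surface_def submanifold_def)
  from form_vanishes_on_slice[OF S(1,2) this x]
  obtain c L R where pc: "planar_chart A S c L R" and xc: "x \<in> cdom c"
    and dens: "area_density c L (R (cmap c x)) = 0" .
  have c: "c \<in> A" using pc by (auto simp: planar_chart_def slice_chart_def)
  obtain s where s: "u = tvec_of_coord A c x (L s)"
    using sub_tangent_space_planar[OF pc xc x u] .
  obtain t where t: "v = tvec_of_coord A c x (L t)"
    using sub_tangent_space_planar[OF pc xc x v] .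
  have "form_at c x (L (axis 1 1)) (L (axis 2 1)) = 0"
    using dens c xc by (simp add: area_density_def planar_chart_coord[OF pc xc x])
  moreover have "form_at c x (L s) (L t)
      = (s$1 * t$2 - s$2 * t$1) * form_at c x (L (axis 1 1)) (L (axis 2 1))"
    by (rule alternating_plane_det[where \<beta>="\<lambda>s t. form_at c x (L s) (L t)"])
      (rule form_at_plane_alternating[OF pc xc])+
  ultimately have "form_at c x (L s) (L t) = 0" by simp
  then show "\<omega> x u v = 0" by (simp add: s t form_at_def)
qed

end

theorem corollary6:
  fixes X :: "'a topology"
    and A :: "('a, 'e::euclidean_space) chart set"
    and \<omega> :: "('a, 'e) form2"
    and f :: "'a \<Rightarrow> 'a"
    and a :: real
    and S :: "'a set"
  assumes "symplectic_manifold X A \<omega>"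
    and "diffeomorphism X A X A f"
    and "0 < a" "a < 1"
    and "\<forall>x\<in>topspace X. \<forall>u\<in>tangent_space A x. \<forall>v\<in>tangent_space A x.
           pullback_form A A f \<omega> x u v = a * \<omega> x u v"
    and "closed_surface X A S"
    and "f ` S = S"
  shows "isotropic A \<omega> S"
proof -
  interpret contracted_form X A \<omega> f a
    by unfold_locales (use assms in \<open>auto simp: symplectic_manifold_def diffeomorphism_def\<close>)
  have "S \<subseteq> topspace X"
    using \<open>closed_surface X A S\<close> by (simp add: closed_surface_def submanifold_def)
  then have "inj_on f S"
    using \<open>diffeomorphism X A X A f\<close> unfolding diffeomorphism_def by (metis inj_on_def subsetD)
  then show ?thesis
    by (rule isotropic_of_invariant_surface[OF \<open>f ` S = S\<close> _ \<open>closed_surface X A S\<close>])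
qed

end
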